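(* Let $p\in\{2,3,5,7,11,13,17,19,23,29,31,41,47,59,71\}$, let $G_p$ be the degree two meromorphic function on $X_0(p)$ that is invariant under $\widetilde{\omega}_p$, has polar divisor $[0]_0+[\infty]_0$, and is normalized so that its lifting to $H$ has expansion $G_p(\tau)=q^{-1}+\sum_{n\ge0}\alpha^p_nq^n$ about $i\infty$. Write $j(\tau)=q^{-1}+744+\sum_{n\ge1}c_nq^n$. Then for all integers $n\ge1$ and $k\geq1$, $$p^{k-1}c_{p^{k-1}n}-p^{k-2}c_{p^{k-2}n}+\cdots+(-1)^{k-1}c_n=p^k\alpha^p_{p^kn}+(-1)^{k-1}\alpha^p_n,$$ that is, $\sum_{i=0}^{k-1}(-1)^{k-1-i}p^{i}c_{p^{i}n}=p^k\alpha^p_{p^kn}+(-1)^{k-1}\alpha^p_n$.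
   Context: $H$ is the upper half-plane, $q=e^{2\pi i\tau}$, and $j$ is the modular invariant of $SL_2(\mathbb{Z})$. $X_0(p)=\Gamma_0(p)\backslash H^*$ is the compact modular curve ($H^*=H\cup\mathbb{Q}\cup\{\infty\}$), with cusps $[0]_0,[\infty]_0$, where $[\tau]_0=\Gamma_0(p)\tau$. $\widetilde{\omega}_p$ is the involution of $X_0(p)$ induced by $\tau\mapsto-1/(p\tau)$. For the listed primes the quotient $X_0(p)/\widetilde{\omega}_p$ has genus zero, so a function $G_p$ as in the claim exists. *)

theory Defs
  imports "HOL-Complex_Analysis.Complex_Analysis"
begin

section \<open>The extended upper half-plane and the curve $X_0(N)$\<close>

datatype point = Fin complex | Infty

definition upper_half_plane :: "complex set" where
  "upper_half_plane = {\<tau>. Im \<tau> > 0}"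

definition extended_uhp :: "point set" where
  "extended_uhp = Fin ` (upper_half_plane \<union> \<rat>) \<union> {Infty}"

definition mat2 :: "int \<Rightarrow> int \<Rightarrow> int \<Rightarrow> int \<Rightarrow> int^2^2" where
  "mat2 a b c d = vector [vector [a, b], vector [c, d]]"

definition moebius :: "int^2^2 \<Rightarrow> point \<Rightarrow> point" where
  "moebius A s =
     (let a = of_int (A$1$1); b = of_int (A$1$2); c = of_int (A$2$1); d = of_int (A$2$2)
      in case s of
           Fin z \<Rightarrow> if c * z + d = 0 then Infty else Fin ((a * z + b) / (c * z + d))
         | Infty \<Rightarrow> if c = 0 then Infty else Fin (a / c))"

definition SL2Z :: "(int^2^2) set" where
  "SL2Z = {A. det A = 1}"

definition Gamma0 :: "nat \<Rightarrow> (int^2^2) set" where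
  "Gamma0 N = {A \<in> SL2Z. int N dvd A$2$1}"

definition orbit0 :: "nat \<Rightarrow> point \<Rightarrow> point set" where
  "orbit0 N s = (\<lambda>A. moebius A s) ` Gamma0 N"

definition X0 :: "nat \<Rightarrow> point set set" where
  "X0 N = orbit0 N ` extended_uhp"

text \<open>The map induced on orbits by $\tau \mapsto -1/(N\tau)$: this map normalises
  $\Gamma_0(N)$, so the image of an orbit is again an orbit.\<close>

definition fricke :: "nat \<Rightarrow> point set \<Rightarrow> point set" where
  "fricke N x = moebius (mat2 0 (-1) (int N) 0) ` x"


section \<open>Meromorphic functions on $X_0(N)$\<close>

text \<open>As in \<^const>\<open>nicely_meromorphic_on\<close>, a meromorphic function is complex-valued
  and takes the value 0 at its poles.\<close>

definition lift_uhp :: "nat \<Rightarrow> (point set \<Rightarrow> complex) \<Rightarrow> complex \<Rightarrow> complex" where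
  "lift_uhp N G \<tau> = G (orbit0 N (Fin \<tau>))"

text \<open>The width of the cusp $A\infty$: the least $h > 0$ such that the conjugate by $A$ of
  the translation $\tau \mapsto \tau + h$ lies in $\Gamma_0(N)$. Since $-1 \in \Gamma_0(N)$,
  no sign has to be taken into account.\<close>

definition cusp_width :: "nat \<Rightarrow> int^2^2 \<Rightarrow> nat" where
  "cusp_width N A = (LEAST h. h > 0 \<and> (\<exists>B\<in>Gamma0 N. B ** A = A ** mat2 1 (int h) 0 1))"

text \<open>The function \<open>G\<close> near the cusp $A\infty$, in the local parameter
  $t = e^{2\pi i\tau/h}$ with $h$ the width of the cusp. By invariance under
  $\Gamma_0(N)$ the choice of the branch of the logarithm is immaterial.\<close>

definition cusp_fun :: "nat \<Rightarrow> (point set \<Rightarrow> complex) \<Rightarrow> int^2^2 \<Rightarrow> complex \<Rightarrow> complex" where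
  "cusp_fun N G A t =
     G (orbit0 N (moebius A
         (if t = 0 then Infty
          else Fin (of_nat (cusp_width N A) * Ln t / (2 * of_real pi * \<i>)))))"

definition meromorphic_on_X0 :: "nat \<Rightarrow> (point set \<Rightarrow> complex) \<Rightarrow> bool" where
  "meromorphic_on_X0 N G \<longleftrightarrow>
     lift_uhp N G nicely_meromorphic_on upper_half_plane \<and>
     (\<forall>A\<in>SL2Z. cusp_fun N G A nicely_meromorphic_on {0})"

text \<open>The order of the stabiliser of \<open>s\<close> in $\Gamma_0(N)/\{\pm 1\}$, i.e. the
  ramification index at \<open>s\<close> of the projection from the upper half-plane.\<close>

definition ramification :: "nat \<Rightarrow> point \<Rightarrow> nat" where
  "ramification N s = card {A \<in> Gamma0 N. moebius A s = s} div 2"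

definition pole_order_uhp :: "nat \<Rightarrow> (point set \<Rightarrow> complex) \<Rightarrow> complex \<Rightarrow> rat" where
  "pole_order_uhp N G \<tau> =
     (if is_pole (lift_uhp N G) \<tau>
      then of_int (- zorder (lift_uhp N G) \<tau>) / of_nat (ramification N (Fin \<tau>)) else 0)"

definition pole_order_cusp :: "nat \<Rightarrow> (point set \<Rightarrow> complex) \<Rightarrow> int^2^2 \<Rightarrow> rat" where
  "pole_order_cusp N G A =
     (if is_pole (cusp_fun N G A) 0 then of_int (- zorder (cusp_fun N G A) 0) else 0)"

text \<open>Every cusp is of the form $A\infty$, and the order does not depend on the choice of $A$.\<close>

definition cusp_matrix :: "point \<Rightarrow> int^2^2" where
  "cusp_matrix s = (SOME A. A \<in> SL2Z \<and> moebius A Infty = s)"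

definition pole_order :: "nat \<Rightarrow> (point set \<Rightarrow> complex) \<Rightarrow> point \<Rightarrow> rat" where
  "pole_order N G s =
     (case s of
        Fin z \<Rightarrow> if z \<in> upper_half_plane then pole_order_uhp N G z
                 else pole_order_cusp N G (cusp_matrix s)
      | Infty \<Rightarrow> pole_order_cusp N G (cusp_matrix s))"

text \<open>Divisors are functions on the points; multiplicities are rational only because
  the order at an elliptic point is written as a quotient (its value is an integer).\<close>

definition polar_divisor :: "nat \<Rightarrow> (point set \<Rightarrow> complex) \<Rightarrow> point set \<Rightarrow> rat" where
  "polar_divisor N G x = (if x \<in> X0 N then pole_order N G (SOME s. s \<in> x) else 0)"

text \<open>The degree of a nonconstant meromorphic function is the degree of its polar divisor.\<close>

definition degree_X0 :: "nat \<Rightarrow> (point set \<Rightarrow> complex) \<Rightarrow> rat" where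
  "degree_X0 N G = (\<Sum>x | polar_divisor N G x \<noteq> 0. polar_divisor N G x)"


section \<open>The modular invariant and expansions in $q$\<close>

definition qpar :: "complex \<Rightarrow> complex" where
  "qpar \<tau> = exp (2 * of_real pi * \<i> * \<tau>)"

definition at_i_infinity :: "complex filter" where
  "at_i_infinity = filtercomap Im at_top"

definition eisenstein :: "nat \<Rightarrow> complex \<Rightarrow> complex" where
  "eisenstein k \<tau> = (\<Sum>\<^sub>\<infinity>(m, n) \<in> UNIV - {(0, 0)}. 1 / (of_int m + of_int n * \<tau>) ^ k)"

definition modular_j :: "complex \<Rightarrow> complex" where
  "modular_j \<tau> =
     (let g2 = 60 * eisenstein 4 \<tau>; g3 = 140 * eisenstein 6 \<tau>
      in 1728 * g2 ^ 3 / (g2 ^ 3 - 27 * g3 ^ 2))"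

end

theory Submission
  imports Defs
begin

text \<open>The case \<open>k = 1\<close>, \<open>c\<^sub>n = p \<alpha>\<^bsub>pn\<^esub> + \<alpha>\<^sub>n\<close>, is the heart of the matter: the alternating sum for
  general \<open>k\<close> telescopes once \<open>p\<^sup>i c\<^bsub>p^i n\<^esub>\<close> is written as
  \<open>p\<^bsup>i+1\<^esup> \<alpha>\<^bsub>p^(i+1) n\<^esub> + p\<^sup>i \<alpha>\<^bsub>p^i n\<^esub>\<close>
  (\<open>alternating_telescope\<close>).

  The case \<open>k = 1\<close> comes from taking the trace of \<open>G\<close> to level one, i.e. summing \<open>G\<close> over the
  \<open>p + 1\<close> cosets of \<open>\<Gamma>\<^sub>0(p)\<close> in \<open>SL\<^sub>2(\<int>)\<close>. The coset representatives \<open>S T\<^sup>j\<close> contribute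
  \<open>G (- 1 / (\<tau> + j))\<close>, which by the Fricke invariance is \<open>G ((\<tau> + j) / p)\<close>. Hence the trace is
  \<open>G \<tau> + (\<Sum>j<p. G ((\<tau> + j) / p))\<close>. Averaging over the \<open>p\<close>-th roots of unity cancels the polar
  terms of the second part and retains the exponents divisible by \<open>p\<close>, so the expansion of
  the trace is \<open>1/q + (\<Sum>n. (\<alpha>\<^sub>n + p \<alpha>\<^bsub>pn\<^esub>) q\<^sup>n)\<close> (\<open>fricke_trace_expansion\<close>).

  Both the trace and \<open>j\<close> are holomorphic on the upper half-plane, the former because \<open>G\<close> has
  its poles at the cusps only (\<open>lift_uhp_holomorphic\<close>), and both are invariant under
  \<open>\<tau> \<mapsto> \<tau> + 1\<close> and \<open>\<tau> \<mapsto> - 1 / \<tau>\<close> (\<open>fricke_trace_S\<close>, \<open>modular_j_S\<close>). Their difference has no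
  polar term, hence is constant by the maximum modulus principle
  (\<open>S_T_invariant_q_series_trivial\<close>), and comparing the coefficients of \<open>q\<^sup>n\<close> finishes the
  proof.\<close>

section \<open>Rigidity of $q$-series invariant under $SL_2(\mathbf{Z})$\<close>

lemma qpar_eq_0_iff [simp]: "qpar \<tau> \<noteq> 0"
  by (simp add: qpar_def)

lemma qpar_Ln: "q \<noteq> 0 \<Longrightarrow> qpar (Ln q / (2 * of_real pi * \<i>)) = q"
  by (simp add: qpar_def)

lemma norm_qpar: "norm (qpar \<tau>) = exp (- 2 * pi * Im \<tau>)"
  by (simp add: qpar_def)

lemma T_invariant_of_int:
  assumes T: "\<And>\<tau>. \<tau> \<in> upper_half_plane \<Longrightarrow> f (\<tau> + 1) = f \<tau>" and "\<tau> \<in> upper_half_plane"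
  shows "f (\<tau> + of_int n) = f \<tau>"
proof -
  have nat: "f (\<sigma> + of_nat m) = f \<sigma>" if "\<sigma> \<in> upper_half_plane" for \<sigma> m
  proof (induction m)
    case (Suc m)
    have "\<sigma> + of_nat m \<in> upper_half_plane"
      using that by (simp add: upper_half_plane_def)
    from T[OF this] Suc show ?case by (simp add: add_ac)
  qed simp
  show ?thesis
  proof (cases "n \<ge> 0")
    case True
    then show ?thesis using nat[of \<tau> "nat n"] assms(2) by simp
  next
    case False
    have "f (\<tau> + of_int n) = f (\<tau> + of_int n + of_nat (nat (- n)))"
      by (rule nat[symmetric]) (use assms(2) in \<open>simp add: upper_half_plane_def\<close>)
    also have "(of_nat (nat (- n)) :: complex) = - of_int n"
      using False by simp
    finally show ?thesis by simp
  qed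
qed

lemma T_invariant_qpar_cong:
  assumes T: "\<And>\<tau>. \<tau> \<in> upper_half_plane \<Longrightarrow> f (\<tau> + 1) = f \<tau>"
    and "\<tau> \<in> upper_half_plane" "qpar \<tau> = qpar \<sigma>"
  shows "f \<sigma> = f \<tau>"
proof -
  obtain n :: int where "2 * of_real pi * \<i> * \<sigma> = 2 * of_real pi * \<i> * \<tau> + (of_int (2 * n) * pi) * \<i>"
    using assms(3)[symmetric] unfolding qpar_def exp_eq by blast
  also have "\<dots> = 2 * of_real pi * \<i> * (\<tau> + of_int n)" by (simp add: algebra_simps)
  finally have "\<sigma> = \<tau> + of_int n" by simp
  then show ?thesis using T_invariant_of_int[of f \<tau> n] assms(1,2) by blast
qed

lemma q_series_holomorphic:
  assumes "\<And>\<tau>. \<tau> \<in> upper_half_plane \<Longrightarrow> ((\<lambda>m. b m * qpar \<tau> ^ m) has_sum f \<tau>) UNIV"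
  shows "f holomorphic_on upper_half_plane"
proof -
  define F where "F q = (\<Sum>m. b m * q ^ m)" for q
  have sums: "(\<lambda>m. b m * qpar \<tau> ^ m) sums f \<tau>" if "\<tau> \<in> upper_half_plane" for \<tau>
    by (rule has_sum_imp_sums[OF assms[OF that]])
  have "F holomorphic_on ball 0 1"
  proof (rule power_series_holomorphic[of 0 1 b])
    fix q :: complex assume q: "q \<in> ball 0 1"
    have "summable (\<lambda>m. b m * q ^ m)"
    proof (cases "q = 0")
      case False
      define \<tau> where "\<tau> = Ln q / (2 * of_real pi * \<i>)"
      have q_eq: "qpar \<tau> = q" using qpar_Ln[OF False] by (simp add: \<tau>_def)
      have "exp (- 2 * pi * Im \<tau>) < exp 0"
        using q by (subst norm_qpar[symmetric]) (simp add: q_eq)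
      then have "\<tau> \<in> upper_half_plane" by (simp add: upper_half_plane_def zero_less_mult_iff)
      from sums[OF this] show ?thesis by (simp add: q_eq sums_iff)
    qed (simp add: summable_0_powser)
    then show "(\<lambda>m. b m * (q - 0) ^ m) sums F q" by (simp add: F_def summable_sums)
  qed
  moreover have "qpar holomorphic_on upper_half_plane"
    unfolding qpar_def by (intro holomorphic_intros)
  moreover have "qpar ` upper_half_plane \<subseteq> ball 0 1"
    by (auto simp: norm_qpar upper_half_plane_def)
  ultimately have "(F \<circ> qpar) holomorphic_on upper_half_plane"
    by (intro holomorphic_on_compose_gen)
  then show ?thesis
    by (rule holomorphic_transform) (use sums in \<open>simp add: F_def sums_iff\<close>)
qed

text \<open>The function \<open>f\<close> becomes a holomorphic function \<open>g\<close> of \<open>q\<close> on the unit disc. On the closed disc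
  of radius \<open>exp (- pi)\<close>, that is for heights at least \<open>1/2\<close>, the modulus of \<open>g\<close> has a maximum.
  If it is attained on the boundary, translate to \<open>\<tau>\<close> of height \<open>1/2\<close> with \<open>\<bar>Re \<tau>\<bar> \<le> 1/2\<close>; then
  \<open>\<bar>\<tau>\<bar> < 1\<close>, so \<open>- 1 / \<tau>\<close> lies higher and yields the same value in the interior. Either
  way the maximum modulus principle makes \<open>g\<close> constant.\<close>

lemma S_T_invariant_q_series_trivial:
  assumes hol: "f holomorphic_on upper_half_plane"
    and T: "\<And>\<tau>. \<tau> \<in> upper_half_plane \<Longrightarrow> f (\<tau> + 1) = f \<tau>"
    and S: "\<And>\<tau>. \<tau> \<in> upper_half_plane \<Longrightarrow> f (- 1 / \<tau>) = f \<tau>"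
    and expansion: "\<forall>\<^sub>F \<tau> in at_i_infinity. ((\<lambda>m. b m * qpar \<tau> ^ m) has_sum f \<tau>) UNIV"
    and m: "m > 0"
  shows "b m = 0"
proof (rule ccontr)
  assume nz: "b m \<noteq> 0"
  \<comment> \<open>The principal branch only fixes a representative modulo \<open>\<tau> \<mapsto> \<tau> + 1\<close>, so \<open>g\<close> has no jump
    across the negative axis.\<close>
  define \<Lambda> where "\<Lambda> q = Ln q / (2 * of_real pi * \<i>)" for q
  define g where "g q = (if q = 0 then b 0 else f (\<Lambda> q))" for q
  have Im_\<Lambda>: "Im (\<Lambda> q) = - ln (norm q) / (2 * pi)" if "q \<noteq> 0" for q
    using that by (simp add: \<Lambda>_def Im_divide power2_eq_square)
  have qpar_\<Lambda>: "qpar (\<Lambda> q) = q" if "q \<noteq> 0" for q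
    using qpar_Ln[OF that] by (simp add: \<Lambda>_def)
  have g_qpar: "g (qpar \<tau>) = f \<tau>" if "\<tau> \<in> upper_half_plane" for \<tau>
    using T_invariant_qpar_cong[of f \<tau> "\<Lambda> (qpar \<tau>)"] T that by (simp add: g_def qpar_\<Lambda>)
  obtain Y where Y: "\<And>\<tau>. Im \<tau> > Y \<Longrightarrow> ((\<lambda>m. b m * qpar \<tau> ^ m) has_sum f \<tau>) UNIV"
    using expansion unfolding at_i_infinity_def eventually_filtercomap_at_top_dense by blast
  define r where "r = min (exp (- 2 * pi * Y)) 1"
  have r: "r > 0" "r \<le> 1" by (auto simp: r_def)
  have g_sums: "(\<lambda>m. b m * q ^ m) sums g q" if "norm q < r" for q
  proof (cases "q = 0")
    case True
    then show ?thesis by (simp add: g_def)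
  next
    case False
    have "ln (norm q) < ln (exp (- 2 * pi * Y))"
      using that False by (subst ln_less_cancel_iff) (auto simp: r_def)
    then have "Im (\<Lambda> q) > Y"
      using False by (simp add: Im_\<Lambda> field_simps)
    from has_sum_imp_sums[OF Y[OF this]] show ?thesis
      using False by (simp add: g_def qpar_\<Lambda>)
  qed
  have hol_at_0: "g holomorphic_on ball 0 r"
    by (rule power_series_holomorphic[of 0 r b]) (use g_sums in auto)
  have hol_off_0: "g field_differentiable at q" if "q \<noteq> 0" "norm q < 1" for q
  proof -
    \<comment> \<open>\<open>h\<close> is a holomorphic branch of the inverse of \<open>qpar\<close> near \<open>q\<close>; it may differ from \<open>\<Lambda>\<close> by
      integers.\<close>
    define D where "D = ball q (norm q) \<inter> ball 0 1"
    define h where "h z = (Ln (z / q) + Ln q) / (2 * of_real pi * \<i>)" for z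
    have re: "Re (z / q) > 0" and z0: "z \<noteq> 0" if "z \<in> D" for z
    proof -
      have "norm (z / q - 1) < 1"
        using that \<open>q \<noteq> 0\<close> by (auto simp: D_def dist_norm norm_minus_commute norm_divide
            diff_divide_eq_iff)
      then show "Re (z / q) > 0"
        using abs_Re_le_cmod[of "z / q - 1"] by simp
      then show "z \<noteq> 0" by auto
    qed
    have h_q: "qpar (h z) = z" if "z \<in> D" for z
      using z0[OF that] \<open>q \<noteq> 0\<close> by (simp add: h_def qpar_def exp_add)
    have h_uhp: "h z \<in> upper_half_plane" if "z \<in> D" for z
    proof -
      have "exp (- 2 * pi * Im (h z)) < exp 0"
        using h_q[OF that] that by (subst norm_qpar[symmetric]) (simp add: D_def)
      then show ?thesis by (simp add: upper_half_plane_def zero_less_mult_iff)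
    qed
    have "h holomorphic_on D"
      unfolding h_def
      by (intro holomorphic_intros)
         (use re \<open>q \<noteq> 0\<close> in \<open>auto simp: complex_nonpos_Reals_iff dest: leD\<close>)
    then have "(f \<circ> h) holomorphic_on D"
      by (rule holomorphic_on_compose_gen[OF _ hol]) (use h_uhp in auto)
    moreover have "(f \<circ> h) z = g z" if "z \<in> D" for z
      using g_qpar[OF h_uhp[OF that]] h_q[OF that] by simp
    ultimately have "g holomorphic_on D"
      by (metis holomorphic_cong)
    moreover have "open D" "q \<in> D" using that by (auto simp: D_def)
    ultimately show ?thesis
      by (rule holomorphic_on_imp_differentiable_at)
  qed
  have g_hol: "g holomorphic_on ball 0 1"
    unfolding holomorphic_on_def
  proof
    fix q :: complex assume "q \<in> ball 0 1"
    have "g field_differentiable at q"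
    proof (cases "q = 0")
      case True
      then show ?thesis
        using hol_at_0 r by (intro holomorphic_on_imp_differentiable_at[OF hol_at_0]) auto
    qed (use hol_off_0 \<open>q \<in> ball 0 1\<close> in auto)
    then show "g field_differentiable at q within ball 0 1"
      by (rule field_differentiable_at_within)
  qed
  define R where "R = exp (- pi)"
  have R: "0 < R" "R < 1" by (auto simp: R_def)
  have "continuous_on (cball 0 R) (\<lambda>q. norm (g q))"
    by (intro continuous_intros continuous_on_subset[OF holomorphic_on_imp_continuous_on[OF g_hol]])
       (use R in auto)
  then obtain q0 where q0: "q0 \<in> cball 0 R" "\<And>q. q \<in> cball 0 R \<Longrightarrow> norm (g q) \<le> norm (g q0)"
    using continuous_attains_sup[of "cball 0 R" "\<lambda>q. norm (g q)"] R by auto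
  obtain q1 where q1: "norm q1 < R" "norm (g q1) = norm (g q0)"
  proof (cases "norm q0 < R")
    case False
    then have nq0: "norm q0 = R" "q0 \<noteq> 0" using q0(1) R by auto
    \<comment> \<open>the translate of the boundary point with \<open>\<bar>Re \<tau>\<bar> \<le> 1/2\<close>\<close>
    define \<tau> where "\<tau> = \<Lambda> q0 - of_int (round (Re (\<Lambda> q0)))"
    have im: "Im \<tau> = 1 / 2"
      by (simp add: \<tau>_def Im_\<Lambda> nq0 R_def)
    have "\<bar>Re \<tau>\<bar> \<le> 1 / 2"
      using of_int_round_abs_le[of "Re (\<Lambda> q0)"] by (simp add: \<tau>_def abs_minus_commute)
    then have "(Re \<tau>)\<^sup>2 \<le> (1 / 2)\<^sup>2"
      by (metis abs_le_square_iff abs_of_nonneg zero_le_divide_1_iff zero_le_numeral)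
    moreover have "(norm \<tau>)\<^sup>2 = (Re \<tau>)\<^sup>2 + 1 / 4"
      by (simp add: cmod_power2 im power_divide)
    ultimately have "(norm \<tau>)\<^sup>2 < 1" by (simp add: power_divide)
    have "\<tau> \<noteq> 0" using im by auto
    then have "1 / 2 / (norm \<tau>)\<^sup>2 > 1 / 2" using \<open>(norm \<tau>)\<^sup>2 < 1\<close> by (simp add: field_simps)
    moreover have "Im (- 1 / \<tau>) = 1 / 2 / (norm \<tau>)\<^sup>2"
      by (simp add: Im_divide im cmod_power2)
    ultimately have "Im (- 1 / \<tau>) > 1 / 2" by linarith
    then have "2 * pi * (1 / 2) < 2 * pi * Im (- 1 / \<tau>)"
      by (intro mult_strict_left_mono) auto
    then have "norm (qpar (- 1 / \<tau>)) < R" by (simp only: norm_qpar R_def exp_less_cancel_iff)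
    moreover have uhp: "\<tau> \<in> upper_half_plane" "- 1 / \<tau> \<in> upper_half_plane"
      using im \<open>Im (- 1 / \<tau>) > 1 / 2\<close> by (auto simp: upper_half_plane_def)
    moreover have "qpar \<tau> = q0"
    proof -
      have "qpar \<tau> = exp (2 * of_real pi * \<i> * \<Lambda> q0 - 2 * of_real pi * \<i> * of_int (round (Re (\<Lambda> q0))))"
        by (simp add: qpar_def \<tau>_def algebra_simps)
      also have "\<dots> = qpar (\<Lambda> q0)"
        unfolding qpar_def exp_eq
        by (rule exI[of _ "- round (Re (\<Lambda> q0))"]) (simp add: algebra_simps)
      finally show ?thesis using qpar_\<Lambda> nq0 by simp
    qed
    ultimately show ?thesis
      using that[of "qpar (- 1 / \<tau>)"] g_qpar[of \<tau>] g_qpar[of "- 1 / \<tau>"] S[of \<tau>] by simp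
  qed (use that in auto)
  have "g constant_on ball 0 1"
    by (rule maximum_modulus_principle[of g "ball 0 1" "ball 0 R" q1])
       (use g_hol q0(2) q1 R in \<open>auto simp: less_imp_le\<close>)
  then have const: "g q = g 0" if "norm q < 1" for q
    using that by (force simp: constant_on_def)
  obtain s where s: "0 < s" "\<And>z. z \<in> cball 0 s - {0} \<Longrightarrow> g z - b 0 \<noteq> 0"
  proof (rule powser_0_nonzero[of r 0 "\<lambda>i. if i = 0 then 0 else b i" "\<lambda>q. g q - b 0" m])
    fix q :: complex assume "norm (q - 0) < r"
    then have "(\<lambda>i. b i * q ^ i - (if i = 0 then b 0 else 0)) sums (g q - b 0)"
      by (intro sums_diff g_sums) (use sums_single[of 0 "\<lambda>_. b 0"] in auto)
    also have "(\<lambda>i. b i * q ^ i - (if i = 0 then b 0 else 0)) =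
               (\<lambda>i. (if i = 0 then 0 else b i) * (q - 0) ^ i)" by auto
    finally show "\<dots> sums (g q - b 0)" .
  qed (use nz m r in \<open>auto simp: g_def\<close>)
  define z where "z = (of_real (min s (1 / 2)) :: complex)"
  have "g z = g 0" by (rule const) (use s in \<open>auto simp: z_def\<close>)
  then have "g z - b 0 = 0" by (simp add: g_def)
  moreover have "z \<in> cball 0 s - {0}" using s(1) by (auto simp: z_def)
  ultimately show False using s(2) by blast
qed

section \<open>The action of $\Gamma_0(N)$ and of the Fricke involution\<close>

lemma mat2_nth [simp]:
  "mat2 a b c d $ 1 $ 1 = a" "mat2 a b c d $ 1 $ 2 = b"
  "mat2 a b c d $ 2 $ 1 = c" "mat2 a b c d $ 2 $ 2 = d"
  by (simp_all add: mat2_def)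

lemma mat2_cases: obtains a b c d where "A = mat2 a b c d"
proof
  show "A = mat2 (A $ 1 $ 1) (A $ 1 $ 2) (A $ 2 $ 1) (A $ 2 $ 2)"
    by (simp add: vec_eq_iff forall_2)
qed

lemma mat2_mult:
  "mat2 a b c d ** mat2 a' b' c' d' =
     mat2 (a * a' + b * c') (a * b' + b * d') (c * a' + d * c') (c * b' + d * d')"
  by (simp add: vec_eq_iff forall_2 matrix_matrix_mult_def sum_2)

lemma det_mat2 [simp]: "det (mat2 a b c d) = a * d - b * c"
  by (simp add: det_2)

lemma mat2_in_Gamma0_iff: "mat2 a b c d \<in> Gamma0 N \<longleftrightarrow> a * d - b * c = 1 \<and> int N dvd c"
  by (simp add: Gamma0_def SL2Z_def)

lemma Gamma0_det: "A \<in> Gamma0 N \<Longrightarrow> det A = 1"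
  by (simp add: Gamma0_def SL2Z_def)

lemma Gamma0_mult:
  assumes "A \<in> Gamma0 N" "B \<in> Gamma0 N" shows "A ** B \<in> Gamma0 N"
proof -
  obtain a b c d where A: "A = mat2 a b c d" by (rule mat2_cases)
  obtain a' b' c' d' where B: "B = mat2 a' b' c' d'" by (rule mat2_cases)
  have "det (A ** B) = 1" using assms by (simp add: det_mul Gamma0_det)
  with assms show ?thesis
    by (auto simp: A B mat2_mult mat2_in_Gamma0_iff)
qed

lemma Gamma0_inverse:
  assumes "A \<in> Gamma0 N" obtains B where "B \<in> Gamma0 N" "B ** A = mat 1"
proof -
  obtain a b c d where A: "A = mat2 a b c d" by (rule mat2_cases)
  show ?thesis
  proof (rule that[of "mat2 d (- b) (- c) a"])
    show "mat2 d (- b) (- c) a ** A = mat 1"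
      using assms unfolding A mat2_mult mat2_in_Gamma0_iff
      by (simp add: vec_eq_iff forall_2 mat_def algebra_simps)
  qed (use assms in \<open>simp add: A mat2_in_Gamma0_iff algebra_simps\<close>)
qed

lemma moebius_denominator_nonzero:
  assumes "z \<in> upper_half_plane" "a * d - b * c > (0::int)"
  shows "of_int c * z + of_int d \<noteq> (0::complex)"
proof
  assume *: "of_int c * z + of_int d = 0"
  then have "Im (of_int c * z + of_int d) = 0" by simp
  then have "c = 0" using assms(1) by (simp add: upper_half_plane_def)
  with * assms(2) show False by simp
qed

lemma Im_moebius:
  fixes a b c d :: int
  shows "Im ((of_int a * z + of_int b) / (of_int c * z + of_int d)) =
     of_int (a * d - b * c) * Im z / (norm (of_int c * z + of_int d))\<^sup>2"
proof -
  have "(of_int a * Im z) * (of_int c * Re z + of_int d) -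
        (of_int a * Re z + of_int b) * (of_int c * Im z) = real_of_int (a * d - b * c) * Im z"
    by (simp add: algebra_simps)
  then show ?thesis by (simp add: Im_divide cmod_power2)
qed

lemma moebius_mat2:
  assumes "z \<in> upper_half_plane" "a * d - b * c > 0"
  shows "moebius (mat2 a b c d) (Fin z) =
           Fin ((of_int a * z + of_int b) / (of_int c * z + of_int d))"
    and "(of_int a * z + of_int b) / (of_int c * z + of_int d) \<in> upper_half_plane"
proof -
  note nz = moebius_denominator_nonzero[OF assms]
  then show "moebius (mat2 a b c d) (Fin z) =
           Fin ((of_int a * z + of_int b) / (of_int c * z + of_int d))"
    by (simp add: moebius_def)
  show "(of_int a * z + of_int b) / (of_int c * z + of_int d) \<in> upper_half_plane"
    unfolding upper_half_plane_def mem_Collect_eq Im_moebius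
    using assms nz by (intro divide_pos_pos mult_pos_pos) (auto simp: upper_half_plane_def simp del: of_int_diff of_int_mult)
qed

lemma moebius_uhp:
  assumes "z \<in> upper_half_plane" "det A > 0"
  obtains w where "w \<in> upper_half_plane" "moebius A (Fin z) = Fin w"
proof -
  obtain a b c d where "A = mat2 a b c d" by (rule mat2_cases)
  with that moebius_mat2[of z a d b c] assms show ?thesis by auto
qed

lemma moebius_mult:
  assumes z: "z \<in> upper_half_plane" and "det A > 0" "det B > 0"
  shows "moebius (A ** B) (Fin z) = moebius A (moebius B (Fin z))"
proof -
  obtain a b c d where A: "A = mat2 a b c d" by (rule mat2_cases)
  obtain a' b' c' d' where B: "B = mat2 a' b' c' d'" by (rule mat2_cases)
  define w where "w = (of_int a' * z + of_int b') / (of_int c' * z + of_int d')"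
  have dA: "a * d - b * c > 0" and dB: "a' * d' - b' * c' > 0" using assms by (auto simp: A B)
  have w: "moebius B (Fin z) = Fin w" "w \<in> upper_half_plane"
    using moebius_mat2[OF z dB] by (auto simp: B w_def)
  have "det (A ** B) > 0" using assms by (simp add: det_mul)
  then have dAB: "(a * a' + b * c') * (c * b' + d * d') - (a * b' + b * d') * (c * a' + d * c') > 0"
    by (simp add: A B mat2_mult)
  note nz = moebius_denominator_nonzero[OF z dB]
  have "moebius (A ** B) (Fin z) =
     Fin ((of_int (a * a' + b * c') * z + of_int (a * b' + b * d')) /
          (of_int (c * a' + d * c') * z + of_int (c * b' + d * d')))"
    unfolding A B mat2_mult by (rule moebius_mat2(1)[OF z dAB])
  also have "(of_int (a * a' + b * c') * z + of_int (a * b' + b * d')) /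
          (of_int (c * a' + d * c') * z + of_int (c * b' + d * d')) =
      (of_int a * w + of_int b) / (of_int c * w + of_int d)"
  proof -
    have "of_int (a * a' + b * c') * z + of_int (a * b' + b * d') =
        (of_int a * w + of_int b) * (of_int c' * z + of_int d')"
      using nz by (simp add: w_def field_simps)
    moreover have "of_int (c * a' + d * c') * z + of_int (c * b' + d * d') =
        (of_int c * w + of_int d) * (of_int c' * z + of_int d')"
      using nz by (simp add: w_def field_simps)
    ultimately show ?thesis using nz by simp
  qed
  also have "Fin \<dots> = moebius A (Fin w)"
    unfolding A by (rule moebius_mat2(1)[OF w(2) dA, symmetric])
  finally show ?thesis by (simp add: w)
qed

lemma orbit0_moebius:
  assumes "B \<in> Gamma0 N" and z: "z \<in> upper_half_plane"
  shows "orbit0 N (moebius B (Fin z)) = orbit0 N (Fin z)"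
proof
  show "orbit0 N (moebius B (Fin z)) \<subseteq> orbit0 N (Fin z)"
  proof
    fix s assume "s \<in> orbit0 N (moebius B (Fin z))"
    then obtain A where "A \<in> Gamma0 N" "s = moebius A (moebius B (Fin z))"
      by (auto simp: orbit0_def)
    then have "s = moebius (A ** B) (Fin z)" "A ** B \<in> Gamma0 N"
      using assms by (auto simp: moebius_mult Gamma0_det Gamma0_mult)
    then show "s \<in> orbit0 N (Fin z)" by (auto simp: orbit0_def)
  qed
  show "orbit0 N (Fin z) \<subseteq> orbit0 N (moebius B (Fin z))"
  proof
    fix s assume "s \<in> orbit0 N (Fin z)"
    then obtain A where A: "A \<in> Gamma0 N" "s = moebius A (Fin z)"
      by (auto simp: orbit0_def)
    obtain C where C: "C \<in> Gamma0 N" "C ** B = mat 1" using Gamma0_inverse[OF assms(1)] .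
    have "A = (A ** C) ** B" by (simp add: matrix_mul_assoc[symmetric] C)
    moreover have "A ** C \<in> Gamma0 N" using A C by (simp add: Gamma0_mult)
    ultimately have "s = moebius (A ** C) (moebius B (Fin z))"
      using A(2) moebius_mult[OF z, of "A ** C" B] assms(1) by (simp add: Gamma0_det)
    with \<open>A ** C \<in> Gamma0 N\<close> show "s \<in> orbit0 N (moebius B (Fin z))"
      by (auto simp: orbit0_def)
  qed
qed

lemma lift_uhp_Gamma0:
  assumes "z \<in> upper_half_plane" "a * d - b * c = 1" "int N dvd c"
  shows "lift_uhp N G ((of_int a * z + of_int b) / (of_int c * z + of_int d)) = lift_uhp N G z"
  using orbit0_moebius[of "mat2 a b c d" N z] moebius_mat2(1)[of z a d b c] assms
  by (simp add: lift_uhp_def mat2_in_Gamma0_iff)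

text \<open>The Fricke matrix normalises \<open>\<Gamma>\<^sub>0(N)\<close>, so it can be moved past the matrices of an orbit.\<close>

lemma fricke_orbit0:
  assumes "N > 0" and z: "z \<in> upper_half_plane"
  shows "fricke N (orbit0 N (Fin z)) = orbit0 N (Fin (- 1 / (of_nat N * z)))"
proof -
  define W where "W = mat2 0 (- 1) (int N) 0"
  have dW: "det W > 0" using assms by (simp add: W_def)
  have Wz: "moebius W (Fin z) = Fin (- 1 / (of_nat N * z))"
    using moebius_mat2(1)[of z 0 0 "-1" "int N"] assms by (simp add: W_def)
  have left: "\<exists>B\<in>Gamma0 N. W ** A = B ** W" and right: "\<exists>B\<in>Gamma0 N. A ** W = W ** B"
    if A_mem: "A \<in> Gamma0 N" for A
  proof -
    obtain a b c d where A: "A = mat2 a b c d" by (rule mat2_cases)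
    obtain e where e: "c = int N * e"
      using A_mem unfolding A mat2_in_Gamma0_iff by (auto elim: dvdE)
    show "\<exists>B\<in>Gamma0 N. W ** A = B ** W"
      by (rule bexI[of _ "mat2 d (- e) (- int N * b) a"])
         (use that in \<open>auto simp: A W_def mat2_mult mat2_in_Gamma0_iff e algebra_simps\<close>)
    show "\<exists>B\<in>Gamma0 N. A ** W = W ** B"
      by (rule bexI[of _ "mat2 d (- e) (- int N * b) a"])
         (use that in \<open>auto simp: A W_def mat2_mult mat2_in_Gamma0_iff e algebra_simps\<close>)
  qed
  have "moebius W ` orbit0 N (Fin z) = orbit0 N (moebius W (Fin z))"
  proof
    show "moebius W ` orbit0 N (Fin z) \<subseteq> orbit0 N (moebius W (Fin z))"
    proof
      fix s assume "s \<in> moebius W ` orbit0 N (Fin z)"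
      then obtain A where A: "A \<in> Gamma0 N" "s = moebius W (moebius A (Fin z))"
        by (auto simp: orbit0_def)
      obtain B where "B \<in> Gamma0 N" "W ** A = B ** W" using left[OF A(1)] by blast
      with A have "s = moebius B (moebius W (Fin z))"
        by (metis Gamma0_det dW moebius_mult z zero_less_one)
      with \<open>B \<in> Gamma0 N\<close> show "s \<in> orbit0 N (moebius W (Fin z))" by (auto simp: orbit0_def)
    qed
    show "orbit0 N (moebius W (Fin z)) \<subseteq> moebius W ` orbit0 N (Fin z)"
    proof
      fix s assume "s \<in> orbit0 N (moebius W (Fin z))"
      then obtain A where A: "A \<in> Gamma0 N" "s = moebius A (moebius W (Fin z))"
        by (auto simp: orbit0_def)
      obtain B where "B \<in> Gamma0 N" "A ** W = W ** B" using right[OF A(1)] by blast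
      with A have "s = moebius W (moebius B (Fin z))"
        by (metis Gamma0_det dW moebius_mult z zero_less_one)
      with \<open>B \<in> Gamma0 N\<close> show "s \<in> moebius W ` orbit0 N (Fin z)" by (auto simp: orbit0_def)
    qed
  qed
  then show ?thesis by (simp add: fricke_def W_def[symmetric] Wz)
qed

lemma lift_uhp_fricke:
  assumes "N > 0" "z \<in> upper_half_plane"
    and "\<And>x. x \<in> X0 N \<Longrightarrow> G (fricke N x) = G x"
  shows "lift_uhp N G (- 1 / (of_nat N * z)) = lift_uhp N G z"
proof -
  have "orbit0 N (Fin z) \<in> X0 N" using assms(2) by (auto simp: X0_def extended_uhp_def)
  from assms(3)[OF this] show ?thesis using fricke_orbit0[OF assms(1,2)] by (simp add: lift_uhp_def)
qed

section \<open>Poles of functions on $X_0(N)$\<close>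

text \<open>The polar divisor divides the order of a pole by the ramification index, so it could
  only fail to see a pole if that index were 0. A matrix fixing \<open>z\<close> has \<open>\<bar>c z + d\<bar> = 1\<close>, because
  it preserves the imaginary part, and then \<open>\<bar>a z + b\<bar> = \<bar>z\<bar>\<close>; both conditions bound the
  integer entries.\<close>

lemma stabiliser_finite:
  assumes z: "z \<in> upper_half_plane"
  shows "finite {A \<in> Gamma0 N. moebius A (Fin z) = Fin z}"
proof -
  define K where "K = (1 + norm z) / Im z"
  define M where "M = \<lceil>(1 + norm z) + K * norm z + K\<rceil>"
  have pos: "Im z > 0" using z by (simp add: upper_half_plane_def)
  have bound: "\<bar>u\<bar> \<le> M \<and> \<bar>v\<bar> \<le> M" if "norm (of_int u * z + of_int v) \<le> 1 + norm z" for u v :: int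
  proof -
    have "\<bar>of_int u * Im z\<bar> \<le> 1 + norm z"
      using abs_Im_le_cmod[of "of_int u * z + of_int v"] that by simp
    then have u: "\<bar>real_of_int u\<bar> \<le> K"
      using pos by (simp add: abs_mult field_simps K_def)
    have "\<bar>real_of_int v\<bar> = norm ((of_int u * z + of_int v) - of_int u * z)" by simp
    also have "\<dots> \<le> (1 + norm z) + \<bar>real_of_int u\<bar> * norm z"
      using norm_triangle_ineq4[of "of_int u * z + of_int v" "of_int u * z"] that
      by (simp add: norm_mult)
    also have "\<dots> \<le> (1 + norm z) + K * norm z"
      using u by (intro add_left_mono mult_right_mono) auto
    finally have v: "\<bar>real_of_int v\<bar> \<le> (1 + norm z) + K * norm z" .
    have "0 \<le> K" "0 \<le> K * norm z" using pos by (simp_all add: K_def)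
    moreover have "(1 + norm z) + K * norm z + K \<le> of_int M" by (simp add: M_def)
    ultimately have "real_of_int \<bar>u\<bar> \<le> real_of_int M" "real_of_int \<bar>v\<bar> \<le> real_of_int M"
      using u v norm_ge_zero[of z] by auto
    then show ?thesis by linarith
  qed
  have "{A \<in> Gamma0 N. moebius A (Fin z) = Fin z} \<subseteq>
     (\<lambda>(a, b, c, d). mat2 a b c d) ` ({- M..M} \<times> {- M..M} \<times> {- M..M} \<times> {- M..M})"
  proof
    fix A assume "A \<in> {A \<in> Gamma0 N. moebius A (Fin z) = Fin z}"
    then have A: "A \<in> Gamma0 N" "moebius A (Fin z) = Fin z" by auto
    obtain a b c d where A': "A = mat2 a b c d" by (rule mat2_cases)
    have det: "a * d - b * c = 1" using A(1) by (simp add: A' mat2_in_Gamma0_iff)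
    have fixed: "(of_int a * z + of_int b) / (of_int c * z + of_int d) = z"
      using A(2) moebius_mat2(1)[OF z, of a d b c] det by (simp add: A')
    have nz: "of_int c * z + of_int d \<noteq> 0"
      by (rule moebius_denominator_nonzero[OF z, of a d b c]) (use det in auto)
    have "Im z = Im z / (norm (of_int c * z + of_int d))\<^sup>2"
      using Im_moebius[of a z b c d] unfolding fixed det by simp
    then have "(norm (of_int c * z + of_int d))\<^sup>2 = 1\<^sup>2"
      using pos nz by (simp add: field_simps)
    then have den: "norm (of_int c * z + of_int d) = 1"
      by (rule power2_eq_imp_eq) auto
    have "of_int a * z + of_int b = z * (of_int c * z + of_int d)"
      using fixed nz by (simp add: field_simps)
    then have "norm (of_int a * z + of_int b) = norm z"
      using den by (simp add: norm_mult)
    then have "\<bar>a\<bar> \<le> M \<and> \<bar>b\<bar> \<le> M" "\<bar>c\<bar> \<le> M \<and> \<bar>d\<bar> \<le> M"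
      using bound[of a b] bound[of c d] den by auto
    then show "A \<in> (\<lambda>(a, b, c, d). mat2 a b c d) `
        ({- M..M} \<times> {- M..M} \<times> {- M..M} \<times> {- M..M})"
      by (intro image_eqI[of _ _ "(a, b, c, d)"]) (auto simp: A')
  qed
  then show ?thesis by (rule finite_subset) auto
qed

lemma ramification_pos:
  assumes z: "z \<in> upper_half_plane"
  shows "ramification N (Fin z) > 0"
proof -
  have "{mat2 1 0 0 1, mat2 (- 1) 0 0 (- 1)} \<subseteq> {A \<in> Gamma0 N. moebius A (Fin z) = Fin z}"
    using z by (auto simp: mat2_in_Gamma0_iff moebius_mat2)
  from card_mono[OF stabiliser_finite[OF z] this]
  have "card {mat2 1 0 0 1, mat2 (- 1) 0 0 (- 1)} \<le> card {A \<in> Gamma0 N. moebius A (Fin z) = Fin z}" .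
  moreover have "mat2 1 0 0 1 \<noteq> mat2 (- 1) 0 0 (- 1)"
    by (metis mat2_nth(1) one_neq_neg_one)
  ultimately show ?thesis by (simp add: ramification_def)
qed

text \<open>The polar divisor evaluates the pole order at an arbitrarily chosen point of the orbit;
  this transports a pole to that point.\<close>

lemma is_pole_lift_uhp_moebius:
  assumes z: "z \<in> upper_half_plane" and B: "B \<in> Gamma0 N" "moebius B (Fin z) = Fin w"
    and pole: "is_pole (lift_uhp N G) z"
  shows "is_pole (lift_uhp N G) w"
proof -
  obtain C where C: "C \<in> Gamma0 N" "C ** B = mat 1" using Gamma0_inverse[OF B(1)] .
  have w: "w \<in> upper_half_plane"
    using moebius_uhp[OF z, of B] B by (auto simp: Gamma0_det)
  have mat1: "mat 1 = mat2 1 0 0 1" by (simp add: vec_eq_iff forall_2 mat_def)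
  have Cw: "moebius C (Fin w) = Fin z"
    using moebius_mult[OF z, of C B] B C moebius_mat2(1)[OF z, of 1 1 0 0] by (simp add: Gamma0_det mat1)
  obtain a b c d where C': "C = mat2 a b c d" by (rule mat2_cases)
  have det: "a * d - b * c = 1" "int N dvd c" using C by (auto simp: C' mat2_in_Gamma0_iff)
  define m where "m u = (of_int a * u + of_int b) / (of_int c * u + of_int d)" for u :: complex
  have inv: "lift_uhp N G (m u) = lift_uhp N G u" if "u \<in> upper_half_plane" for u
    unfolding m_def by (rule lift_uhp_Gamma0[OF that det])
  have nz: "of_int c * u + of_int d \<noteq> (0::complex)" if "u \<in> upper_half_plane" for u
    by (rule moebius_denominator_nonzero[OF that, of a d b c]) (use det in auto)
  have mw: "m w = z" using Cw moebius_mat2(1)[OF w, of a d b c] det by (simp add: C' m_def)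
  have open_uhp: "open upper_half_plane"
    by (simp add: upper_half_plane_def open_halfspace_Im_gt)
  have ev: "\<forall>\<^sub>F u in at w. u \<in> upper_half_plane \<and> u \<noteq> w"
    using open_uhp w by (intro eventually_conj eventually_at_in_open' eventually_neq_at_within)
  have "filterlim m (at z) (at w)"
    unfolding filterlim_at
  proof
    show "\<forall>\<^sub>F u in at w. m u \<in> UNIV \<and> m u \<noteq> z"
      using ev
    proof eventually_elim
      case (elim u)
      have "m u \<noteq> m w"
      proof
        assume "m u = m w"
        then have "(of_int a * u + of_int b) * (of_int c * w + of_int d) =
                   (of_int a * w + of_int b) * (of_int c * u + of_int d)"
          using nz[of u] nz[of w] elim w by (simp add: m_def frac_eq_eq)
        then have "(of_int (a * d - b * c) :: complex) * (u - w) = 0"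
          by (simp add: algebra_simps)
        then show False using det elim by simp
      qed
      then show ?case by (simp add: mw)
    qed
    have "isCont m w" unfolding m_def using nz[OF w] by (intro continuous_intros) auto
    then show "(m \<longlongrightarrow> z) (at w)" by (simp add: isCont_def mw)
  qed
  with pole have "filterlim (\<lambda>u. lift_uhp N G (m u)) at_infinity (at w)"
    unfolding is_pole_def by (rule filterlim_compose)
  moreover have "\<forall>\<^sub>F u in at w. lift_uhp N G (m u) = lift_uhp N G u"
    using ev by eventually_elim (simp add: inv)
  ultimately show ?thesis
    unfolding is_pole_def by (simp add: filterlim_cong[OF refl refl])
qed

lemma orbit0_cusp_neq:
  assumes "z \<in> upper_half_plane"
  shows "orbit0 N (Fin z) \<noteq> orbit0 N (Fin 0)" "orbit0 N (Fin z) \<noteq> orbit0 N Infty"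
proof -
  have "Fin z = moebius (mat2 1 0 0 1) (Fin z)" using assms by (simp add: moebius_mat2)
  then have "Fin z \<in> orbit0 N (Fin z)"
    unfolding orbit0_def by (rule image_eqI) (simp add: mat2_in_Gamma0_iff)
  moreover have "Fin z \<notin> orbit0 N (Fin 0)" "Fin z \<notin> orbit0 N Infty"
    using assms by (auto simp: orbit0_def moebius_def Let_def upper_half_plane_def Im_divide split: if_splits)
  ultimately show "orbit0 N (Fin z) \<noteq> orbit0 N (Fin 0)" "orbit0 N (Fin z) \<noteq> orbit0 N Infty"
    by auto
qed

lemma lift_uhp_holomorphic:
  assumes mero: "meromorphic_on_X0 N G"
    and div: "\<And>z. z \<in> upper_half_plane \<Longrightarrow> polar_divisor N G (orbit0 N (Fin z)) = 0"
  shows "lift_uhp N G holomorphic_on upper_half_plane"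
proof -
  define L where "L = lift_uhp N G"
  have nice: "L nicely_meromorphic_on upper_half_plane"
    using mero by (simp add: meromorphic_on_X0_def L_def)
  have no_pole: "\<not> is_pole L z" if z: "z \<in> upper_half_plane" for z
  proof
    assume pole: "is_pole L z"
    define s where "s = (SOME s. s \<in> orbit0 N (Fin z))"
    have "orbit0 N (Fin z) \<noteq> {}"
      unfolding orbit0_def using mat2_in_Gamma0_iff[of 1 0 0 1 N] by auto
    then have "s \<in> orbit0 N (Fin z)" unfolding s_def by (simp add: some_in_eq)
    then obtain B where B: "B \<in> Gamma0 N" "s = moebius B (Fin z)" by (auto simp: orbit0_def)
    then obtain w where w: "w \<in> upper_half_plane" "s = Fin w"
      using moebius_uhp[OF z, of B] by (auto simp: Gamma0_det)
    have pole_w: "is_pole L w"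
      using is_pole_lift_uhp_moebius[OF z B(1)] B(2) w pole by (simp add: L_def)
    have "isolated_singularity_at L w"
      using nice w meromorphic_on_isolated_singularity meromorphic_on_subset
      unfolding nicely_meromorphic_on_def by (metis empty_subsetI insert_subset)
    then have "zorder L w < 0" using pole_w by (rule isolated_pole_imp_neg_zorder)
    moreover have "orbit0 N (Fin z) \<in> X0 N" using z by (auto simp: X0_def extended_uhp_def)
    ultimately have "polar_divisor N G (orbit0 N (Fin z)) \<noteq> 0"
      using pole_w w ramification_pos[OF w(1), of N]
      by (simp add: polar_divisor_def s_def[symmetric] pole_order_def pole_order_uhp_def L_def[symmetric])
    with div[OF z] show False by simp
  qed
  have "L analytic_on upper_half_plane"
    using nicely_meromorphic_on_imp_analytic_at[OF nice] no_pole analytic_on_analytic_at by blast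
  then show ?thesis unfolding L_def by (rule analytic_imp_holomorphic)
qed

section \<open>Invariance of $j$\<close>

text \<open>Substitution in the lattice sum and multiplication by a constant are valid for
  \<open>infsum\<close> whether or not the sum converges, so the transformation laws hold for every weight.\<close>

lemma eisenstein_T: "eisenstein k (\<tau> + 1) = eisenstein k \<tau>"
  unfolding eisenstein_def
  by (rule infsum_reindex_bij_witness
        [of _ "\<lambda>(m, n). (m - n, n)" "\<lambda>(m, n). (m + n, n)"])
     (auto simp: algebra_simps)

lemma eisenstein_S:
  assumes "\<tau> \<noteq> 0"
  shows "eisenstein k (- 1 / \<tau>) = \<tau> ^ k * eisenstein k \<tau>"
proof -
  have "eisenstein k (- 1 / \<tau>) =
        (\<Sum>\<^sub>\<infinity>(m, n) \<in> UNIV - {(0, 0)}. \<tau> ^ k * (1 / (of_int m + of_int n * \<tau>) ^ k))"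
    unfolding eisenstein_def
  proof (rule infsum_reindex_bij_witness[of _ "\<lambda>(m, n). (n, - m)" "\<lambda>(m, n). (- n, m)"])
    fix x :: "int \<times> int"
    obtain m n where x: "x = (m, n)" by (cases x)
    have "of_int m + of_int n * (- 1 / \<tau>) = (of_int (- n) + of_int m * \<tau>) / \<tau>"
      using assms by (simp add: field_simps)
    then show "(case case x of (m, n) \<Rightarrow> (- n, m) of
             (m, n) \<Rightarrow> \<tau> ^ k * (1 / (of_int m + of_int n * \<tau>) ^ k)) =
          (case x of (m, n) \<Rightarrow> 1 / (of_int m + of_int n * (- 1 / \<tau>)) ^ k)"
      unfolding x prod.case by (simp only: power_divide) simp
  qed auto
  also have "\<dots> = \<tau> ^ k * eisenstein k \<tau>"
    unfolding eisenstein_def by (subst infsum_cmult_right'[symmetric]) (simp add: case_prod_unfold)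
  finally show ?thesis .
qed

lemma modular_j_T: "modular_j (\<tau> + 1) = modular_j \<tau>"
  by (simp add: modular_j_def eisenstein_T)

lemma modular_j_S:
  assumes "\<tau> \<noteq> 0"
  shows "modular_j (- 1 / \<tau>) = modular_j \<tau>"
proof -
  define g2 g3 where "g2 = 60 * eisenstein 4 \<tau>" and "g3 = 140 * eisenstein 6 \<tau>"
  have "modular_j (- 1 / \<tau>) =
      1728 * (\<tau> ^ 4 * g2) ^ 3 / ((\<tau> ^ 4 * g2) ^ 3 - 27 * (\<tau> ^ 6 * g3) ^ 2)"
    unfolding modular_j_def Let_def eisenstein_S[OF assms] g2_def g3_def by (simp only: mult.left_commute)
  also have "\<dots> = \<tau> ^ 12 * (1728 * g2 ^ 3) / (\<tau> ^ 12 * (g2 ^ 3 - 27 * g3 ^ 2))"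
    by (simp add: algebra_simps power_mult_distrib flip: power_mult)
  also have "\<dots> = modular_j \<tau>"
    using assms by (simp add: modular_j_def Let_def g2_def g3_def)
  finally show ?thesis .
qed

section \<open>The trace to level one\<close>

text \<open>For a function \<open>L\<close> on the upper half-plane that is invariant under \<open>\<Gamma>\<^sub>0(N)\<close> and the Fricke
  involution, with \<open>N\<close> prime, this is the sum of \<open>L \<circ> A\<close> over representatives \<open>A\<close> of the cosets
  \<open>\<Gamma>\<^sub>0(N) A\<close> in \<open>SL\<^sub>2(\<int>)\<close>.\<close>

definition fricke_trace :: "nat \<Rightarrow> (complex \<Rightarrow> complex) \<Rightarrow> complex \<Rightarrow> complex" where
  "fricke_trace N L \<tau> = L \<tau> + (\<Sum>j<N. L ((\<tau> + of_nat j) / of_nat N))"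

lemma uhp_affine:
  "\<tau> \<in> upper_half_plane \<Longrightarrow> N > 0 \<Longrightarrow> (\<tau> + of_nat j) / of_nat N \<in> upper_half_plane"
  by (simp add: upper_half_plane_def)

lemma fricke_trace_holomorphic:
  assumes "N > 0" "L holomorphic_on upper_half_plane"
  shows "fricke_trace N L holomorphic_on upper_half_plane"
  unfolding fricke_trace_def
proof (intro holomorphic_intros assms(2))
  fix j
  have "(\<lambda>\<tau>. (\<tau> + of_nat j) / of_nat N) holomorphic_on upper_half_plane"
    using assms(1) by (intro holomorphic_intros) auto
  from holomorphic_on_compose_gen[OF this assms(2)]
  show "(\<lambda>\<tau>. L ((\<tau> + of_nat j) / of_nat N)) holomorphic_on upper_half_plane"
    using assms(1) uhp_affine by (auto simp: o_def)
qed

lemma fricke_trace_T: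
  assumes "N > 0" and "\<tau> \<in> upper_half_plane"
    and T: "\<And>\<tau>. \<tau> \<in> upper_half_plane \<Longrightarrow> L (\<tau> + 1) = L \<tau>"
  shows "fricke_trace N L (\<tau> + 1) = fricke_trace N L \<tau>"
proof -
  define h where "h j = L ((\<tau> + of_nat j) / of_nat N)" for j
  have "h N = h 0"
    using T[OF uhp_affine[of \<tau> N 0]] assms(1,2) by (simp add: h_def add_divide_distrib)
  then have "(\<Sum>j<N. h (Suc j)) = (\<Sum>j<N. h j)"
    using sum.lessThan_Suc_shift[of h N] by (simp add: add.commute)
  moreover have "L ((\<tau> + 1 + of_nat j) / of_nat N) = h (Suc j)" for j
    by (simp add: h_def add_ac)
  ultimately show ?thesis using T[OF assms(2)] by (simp add: fricke_trace_def h_def)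
qed

lemma negative_inverse_mod_prime:
  fixes p :: nat
  assumes "prime p"
  obtains \<sigma> where
    "\<And>j. j \<in> {1..<p} \<Longrightarrow> \<sigma> j \<in> {1..<p} \<and> p dvd j * \<sigma> j + 1 \<and> \<sigma> (\<sigma> j) = j"
proof -
  define P where "P j i \<longleftrightarrow> i \<in> {1..<p} \<and> p dvd j * i + 1" for j i :: nat
  have ex: "\<exists>i. P j i" if j: "j \<in> {1..<p}" for j
  proof -
    have "\<not> p dvd j" using j by (auto dest: dvd_imp_le)
    then have "coprime j p"
      using prime_imp_coprime[OF assms] coprime_commute by blast
    then have "coprime (int j) (int p)" by simp
    then obtain x y where xy: "x * int j + y * int p = 1"
      by (metis bezout_int coprime_imp_gcd_eq_1)
    define i where "i = nat ((- x) mod int p)"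
    have pos: "p > 0" using j by simp
    have i: "int i = (- x) mod int p" using pos by (simp add: i_def)
    have "int (j * i + 1) = int j * ((- x) mod int p) + 1" by (simp add: i)
    also have "\<dots> mod int p = (int j * (- x) + 1) mod int p"
      by (rule mod_add_cong[OF mod_mult_right_eq refl])
    also have "int j * (- x) + 1 = y * int p" using xy by (simp add: algebra_simps)
    finally have "int p dvd int (j * i + 1)" by (simp add: dvd_eq_mod_eq_0)
    then have dvd: "p dvd j * i + 1" by (simp only: of_nat_dvd_iff)
    have "i < p" using i pos by (metis of_nat_0_less_iff of_nat_less_iff pos_mod_bound)
    moreover have "i \<noteq> 0" using dvd prime_gt_1_nat[OF assms] by (intro notI) auto
    ultimately show ?thesis using dvd by (intro exI[of _ i]) (simp add: P_def)
  qed
  have unique: "i = i'" if "j \<in> {1..<p}" "P j i" "P j i'" for i i' j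
  proof -
    have "int p dvd int (j * i + 1) - int (j * i' + 1)"
      using that by (intro dvd_diff) (auto simp: P_def simp del: of_nat_Suc of_nat_add)
    also have "\<dots> = int j * (int i - int i')" by (simp add: algebra_simps)
    finally have "int p dvd int i - int i'"
      using that(1) assms by (auto simp: prime_dvd_mult_iff dest: zdvd_imp_le)
    moreover have "\<bar>int i - int i'\<bar> < int p" using that by (auto simp: P_def)
    ultimately show ?thesis using zdvd_not_zless[of "\<bar>int i - int i'\<bar>" "int p"] by fastforce
  qed
  show ?thesis
  proof (rule that[of "\<lambda>j. SOME i. P j i"])
    fix j assume j: "j \<in> {1..<p}"
    define i where "i = (SOME i. P j i)"
    have i: "P j i" unfolding i_def by (rule someI_ex[OF ex[OF j]])
    then have i': "i \<in> {1..<p}" "P i j" using j by (auto simp: P_def mult.commute)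
    have "(SOME j. P i j) = j"
      by (rule unique[OF i'(1) someI_ex[OF ex[OF i'(1)]] i'(2)])
    moreover have "i \<in> {1..<p} \<and> p dvd j * i + 1" using i by (simp add: P_def)
    ultimately show "(SOME i. P j i) \<in> {1..<p} \<and> p dvd j * (SOME i. P j i) + 1 \<and>
        (SOME k. P (SOME i. P j i) k) = j"
      unfolding i_def[symmetric] by blast
  qed
qed

text \<open>Under \<open>\<tau> \<mapsto> - 1 / \<tau>\<close> the term \<open>L \<tau>\<close> and the term for \<open>j = 0\<close> are swapped by the Fricke
  invariance. For \<open>0 < j < p\<close> choose \<open>i\<close> with \<open>j i + 1 = p e\<close>; the matrix with rows
  \<open>(j, - e)\<close> and \<open>(p, - i)\<close> lies in \<open>\<Gamma>\<^sub>0(p)\<close> and maps \<open>(\<tau> + i) / p\<close> to \<open>(- 1 / \<tau> + j) / p\<close>, so the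
  remaining terms are permuted by the involution \<open>j \<mapsto> i\<close> of the nonzero residues.\<close>

lemma fricke_trace_S:
  assumes p: "prime p" and \<tau>: "\<tau> \<in> upper_half_plane"
    and Gamma0: "\<And>z a b c d. z \<in> upper_half_plane \<Longrightarrow> a * d - b * c = 1 \<Longrightarrow> int p dvd c \<Longrightarrow>
          L ((of_int a * z + of_int b) / (of_int c * z + of_int d)) = L z"
    and fricke: "\<And>z. z \<in> upper_half_plane \<Longrightarrow> L (- 1 / (of_nat p * z)) = L z"
  shows "fricke_trace p L (- 1 / \<tau>) = fricke_trace p L \<tau>"
proof -
  have pos: "p > 0" using p by (simp add: prime_gt_0_nat)
  have nz: "\<tau> \<noteq> 0" using \<tau> by (auto simp: upper_half_plane_def)
  define h h' where "h j = L ((\<tau> + of_nat j) / of_nat p)"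
    and "h' j = L ((- 1 / \<tau> + of_nat j) / of_nat p)" for j
  obtain \<sigma> where \<sigma>:
    "\<And>j. j \<in> {1..<p} \<Longrightarrow> \<sigma> j \<in> {1..<p} \<and> p dvd j * \<sigma> j + 1 \<and> \<sigma> (\<sigma> j) = j"
    using negative_inverse_mod_prime[OF p] by blast
  have split: "(\<Sum>j<p. u j) = u 0 + (\<Sum>j\<in>{1..<p}. u j)" for u :: "nat \<Rightarrow> complex"
    using pos by (simp add: lessThan_atLeast0 sum.atLeast_Suc_lessThan)
  have "L (- 1 / \<tau>) = h 0"
    using fricke[OF uhp_affine[OF \<tau> pos, of 0]] pos by (simp add: h_def)
  moreover have "h' 0 = L \<tau>"
    using fricke[OF \<tau>] by (simp add: h'_def mult.commute)
  moreover have "(\<Sum>j\<in>{1..<p}. h' j) = (\<Sum>j\<in>{1..<p}. h j)"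
  proof (rule sum.reindex_bij_witness[of _ \<sigma> \<sigma>])
    fix j assume j: "j \<in> {1..<p}"
    obtain e where e: "j * \<sigma> j + 1 = p * e" using \<sigma>[OF j] by (auto elim: dvdE)
    then have e': "of_nat j * of_nat (\<sigma> j) + 1 = (of_nat p * of_nat e :: complex)"
      by (metis of_nat_1 of_nat_add of_nat_mult)
    have e'': "int j * int (\<sigma> j) + 1 = int p * int e" using e by (metis of_nat_1 of_nat_add of_nat_mult)
    define z where "z = (\<tau> + of_nat (\<sigma> j)) / of_nat p"
    have z: "z \<in> upper_half_plane" unfolding z_def by (rule uhp_affine[OF \<tau> pos])
    have "L ((of_int (int j) * z + of_int (- int e)) / (of_int (int p) * z + of_int (- int (\<sigma> j)))) = L z"
      using e'' by (intro Gamma0[OF z]) (auto simp: algebra_simps)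
    moreover have "of_int (int p) * z + of_int (- int (\<sigma> j)) = \<tau>" using pos by (simp add: z_def)
    moreover have "of_int (int j) * z + of_int (- int e) = (of_nat j * \<tau> - 1) / of_nat p"
    proof -
      have pz: "of_nat p * z = \<tau> + of_nat (\<sigma> j)" using pos by (simp add: z_def)
      have "of_nat p * (of_int (int j) * z + of_int (- int e)) =
          of_nat j * (of_nat p * z) - of_nat p * of_nat e" by (simp add: algebra_simps)
      also have "\<dots> = of_nat j * \<tau> - 1" unfolding e'[symmetric] pz by (simp add: algebra_simps)
      finally show ?thesis using pos by (simp add: field_simps)
    qed
    moreover have "(of_nat j * \<tau> - 1) / of_nat p / \<tau> = (- 1 / \<tau> + of_nat j) / of_nat p"
      using nz pos by (simp add: field_simps)
    ultimately show "h (\<sigma> j) = h' j" by (simp add: h_def h'_def z_def)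
  qed (use \<sigma> in auto)
  ultimately show ?thesis
    unfolding fricke_trace_def h_def[symmetric] h'_def[symmetric] split by (simp add: add_ac)
qed

lemma sum_power_root_of_unity:
  assumes "x ^ N = 1"
  shows "(\<Sum>j<N. x ^ j) = (if x = 1 then of_nat N else (0::complex))"
  using assms by (simp add: sum_gp_strict)

lemma qpar_fraction_power_eq_1_iff:
  assumes "N > 0"
  shows "qpar (1 / of_nat N) ^ m = 1 \<longleftrightarrow> N dvd m"
proof -
  have "qpar (1 / of_nat N) ^ m = exp (2 * of_real pi * \<i> * of_nat m / of_nat N)"
    by (simp add: qpar_def exp_of_nat_mult[symmetric] mult_ac)
  then have "qpar (1 / of_nat N) ^ m = 1 \<longleftrightarrow>
      (\<exists>n::int. 2 * pi * of_nat m / of_nat N = of_int (2 * n) * pi)"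
    by (simp add: exp_eq_1)
  also have "\<dots> \<longleftrightarrow> (\<exists>n::int. real m = real_of_int (n * int N))"
    using assms by (simp add: field_simps)
  also have "\<dots> \<longleftrightarrow> (\<exists>n::int. int m = n * int N)"
    by (metis of_int_eq_iff of_int_of_nat_eq)
  also have "\<dots> \<longleftrightarrow> int N dvd int m" by (auto simp: dvd_def mult.commute)
  finally show ?thesis by simp
qed

lemma has_sum_sum:
  fixes g :: "'i \<Rightarrow> 'a \<Rightarrow> complex"
  assumes "finite I" "\<And>i. i \<in> I \<Longrightarrow> (g i has_sum s i) A"
  shows "((\<lambda>x. \<Sum>i\<in>I. g i x) has_sum (\<Sum>i\<in>I. s i)) A"
  using assms by (induction I rule: finite_induct) (auto intro!: has_sum_add)

lemma fricke_trace_expansion: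
  assumes N: "N > 1"
    and expansion: "\<forall>\<^sub>F \<tau> in at_i_infinity.
      ((\<lambda>m. \<alpha> m * qpar \<tau> ^ m) has_sum (L \<tau> - inverse (qpar \<tau>))) UNIV"
  shows "\<forall>\<^sub>F \<tau> in at_i_infinity.
      ((\<lambda>m. (\<alpha> m + of_nat N * \<alpha> (N * m)) * qpar \<tau> ^ m) has_sum
        (fricke_trace N L \<tau> - inverse (qpar \<tau>))) UNIV"
proof -
  obtain Y where Y: "\<And>\<tau>. Im \<tau> > Y \<Longrightarrow>
      ((\<lambda>m. \<alpha> m * qpar \<tau> ^ m) has_sum (L \<tau> - inverse (qpar \<tau>))) UNIV"
    using expansion unfolding at_i_infinity_def eventually_filtercomap_at_top_dense by blast
  show ?thesis
    unfolding at_i_infinity_def eventually_filtercomap_at_top_dense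
  \<comment> \<open>The expansion of \<open>L\<close> is used at the points \<open>(\<tau> + j) / N\<close>, whose height is \<open>Im \<tau> / N\<close>.\<close>
  proof (intro exI[of _ "real N * \<bar>Y\<bar>"] allI impI)
    fix \<tau> assume \<tau>: "Im \<tau> > real N * \<bar>Y\<bar>"
    have "1 * \<bar>Y\<bar> \<le> real N * \<bar>Y\<bar>" using N by (intro mult_right_mono) auto
    with \<tau> have Y1: "Im \<tau> > Y" by linarith
    have "\<bar>Y\<bar> < Im \<tau> / real N" using \<tau> N by (simp add: field_simps)
    then have Y2: "Im ((\<tau> + of_nat j) / of_nat N) > Y" for j using N by simp
    define \<zeta> where "\<zeta> = qpar (1 / of_nat N)"
    define r where "r = qpar (\<tau> / of_nat N)"
    have r_pow: "r ^ (N * m) = qpar \<tau> ^ m" for m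
      using N by (simp add: r_def qpar_def exp_of_nat_mult[symmetric] power_mult)
    have q_j: "qpar ((\<tau> + of_nat j) / of_nat N) = r * \<zeta> ^ j" for j
      by (simp add: r_def \<zeta>_def qpar_def exp_of_nat_mult[symmetric] exp_add[symmetric]
          add_divide_distrib algebra_simps)
    have \<zeta>_iff: "\<zeta> ^ m = 1 \<longleftrightarrow> N dvd m" for m
      unfolding \<zeta>_def using N by (intro qpar_fraction_power_eq_1_iff) auto
    have \<zeta>_ne: "\<zeta> \<noteq> 1" using \<zeta>_iff[of 1] N by simp
    have sum_pow: "(\<Sum>j<N. (r * \<zeta> ^ j) ^ m) = (if N dvd m then of_nat N * r ^ m else 0)" for m
    proof -
      have "(\<Sum>j<N. (r * \<zeta> ^ j) ^ m) = r ^ m * (\<Sum>j<N. (\<zeta> ^ m) ^ j)"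
        by (simp add: power_mult_distrib sum_distrib_left mult.commute flip: power_mult)
      also have "(\<zeta> ^ m) ^ N = 1" by (simp add: power_mult[symmetric] \<zeta>_iff)
      then have "(\<Sum>j<N. (\<zeta> ^ m) ^ j) = (if N dvd m then of_nat N else 0)"
        by (simp add: sum_power_root_of_unity \<zeta>_iff)
      finally show ?thesis by simp
    qed
    have sum_inv: "(\<Sum>j<N. inverse (r * \<zeta> ^ j)) = 0"
    proof -
      have "(\<Sum>j<N. inverse (r * \<zeta> ^ j)) = inverse r * (\<Sum>j<N. inverse \<zeta> ^ j)"
        by (simp add: sum_distrib_left power_inverse)
      also have "(\<Sum>j<N. inverse \<zeta> ^ j) = 0"
        by (subst sum_power_root_of_unity) (use \<zeta>_iff[of N] \<zeta>_ne in \<open>auto simp: power_inverse\<close>)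
      finally show ?thesis by simp
    qed
    have "((\<lambda>m. \<Sum>j<N. \<alpha> m * (r * \<zeta> ^ j) ^ m) has_sum
           (\<Sum>j<N. L ((\<tau> + of_nat j) / of_nat N) - inverse (r * \<zeta> ^ j))) UNIV"
      by (rule has_sum_sum) (use Y[OF Y2] in \<open>simp_all add: q_j\<close>)
    then have "((\<lambda>m. if N dvd m then of_nat N * \<alpha> m * r ^ m else 0) has_sum
           (\<Sum>j<N. L ((\<tau> + of_nat j) / of_nat N))) UNIV"
      unfolding sum_subtractf sum_inv sum_distrib_left[symmetric] sum_pow
      by (simp add: if_distrib mult_ac cong: if_cong)
    also have "?this \<longleftrightarrow> ((\<lambda>m. of_nat N * \<alpha> m * r ^ m) has_sum
           (\<Sum>j<N. L ((\<tau> + of_nat j) / of_nat N))) (range ((*) N))"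
      by (rule has_sum_cong_neutral) auto
    also have "\<dots> \<longleftrightarrow> ((\<lambda>m. of_nat N * \<alpha> (N * m) * qpar \<tau> ^ m) has_sum
           (\<Sum>j<N. L ((\<tau> + of_nat j) / of_nat N))) UNIV"
      using N by (subst has_sum_reindex) (simp_all add: o_def r_pow inj_on_def)
    finally have "((\<lambda>m. of_nat N * \<alpha> (N * m) * qpar \<tau> ^ m) has_sum
           (\<Sum>j<N. L ((\<tau> + of_nat j) / of_nat N))) UNIV" .
    from has_sum_add[OF Y[OF Y1] this]
    show "((\<lambda>m. (\<alpha> m + of_nat N * \<alpha> (N * m)) * qpar \<tau> ^ m) has_sum
        (fricke_trace N L \<tau> - inverse (qpar \<tau>))) UNIV"
      by (simp add: fricke_trace_def algebra_simps)
  qed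
qed

section \<open>The coefficient identity\<close>

lemma alternating_telescope:
  fixes b t :: "nat \<Rightarrow> complex"
  assumes "\<And>i. t i = b (Suc i) + b i"
  shows "(\<Sum>i = 0..k. (- 1) ^ (k - i) * t i) = b (Suc k) + (- 1) ^ k * b 0"
proof (induction k)
  case (Suc k)
  have "(\<Sum>i = 0..k. (- 1) ^ (Suc k - i) * t i) = - (\<Sum>i = 0..k. (- 1) ^ (k - i) * t i)"
    unfolding sum_negf[symmetric] by (rule sum.cong) (auto simp: Suc_diff_le)
  then show ?case using Suc assms by (simp add: sum.atLeast0_atMost_Suc)
qed (simp add: assms)

theorem mainTheorem7:
  fixes p :: nat
    and G :: "point set \<Rightarrow> complex"
    and \<alpha> c :: "nat \<Rightarrow> complex"
    and n k :: nat
  assumes p: "p \<in> {2, 3, 5, 7, 11, 13, 17, 19, 23, 29, 31, 41, 47, 59, 71}"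
    and G_meromorphic: "meromorphic_on_X0 p G"
    and G_degree: "degree_X0 p G = 2"
    and G_invariant: "\<And>x. x \<in> X0 p \<Longrightarrow> G (fricke p x) = G x"
    and G_poles: "polar_divisor p G =
           (\<lambda>x. of_bool (x = orbit0 p (Fin 0)) + of_bool (x = orbit0 p Infty))"
    and G_expansion: "\<forall>\<^sub>F \<tau> in at_i_infinity.
           ((\<lambda>m. \<alpha> m * qpar \<tau> ^ m) has_sum (lift_uhp p G \<tau> - inverse (qpar \<tau>))) UNIV"
    and j_expansion: "\<And>\<tau>. \<tau> \<in> upper_half_plane \<Longrightarrow>
           ((\<lambda>m. c m * qpar \<tau> ^ m) has_sum (modular_j \<tau> - inverse (qpar \<tau>) - 744)) {1..}"
    and n: "n \<ge> 1"
    and k: "k \<ge> 1"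
  shows "(\<Sum>i = 0..k - 1. (- 1) ^ (k - 1 - i) * of_nat p ^ i * c (p ^ i * n)) =
           of_nat p ^ k * \<alpha> (p ^ k * n) + (- 1) ^ (k - 1) * \<alpha> n"
proof -
  have prime: "prime p" using p by auto
  have pos: "p > 0" "p > 1" using prime_gt_1_nat[OF prime] by auto
  define L where "L = lift_uhp p G"
  have Gamma0: "L ((of_int a * z + of_int b) / (of_int c * z + of_int d)) = L z"
    if "z \<in> upper_half_plane" "a * d - b * c = 1" "int p dvd c" for z a b c d
    unfolding L_def by (rule lift_uhp_Gamma0[OF that])
  have fricke: "L (- 1 / (of_nat p * z)) = L z" if "z \<in> upper_half_plane" for z
    unfolding L_def by (rule lift_uhp_fricke[OF pos(1) that]) (rule G_invariant)
  have L_hol: "L holomorphic_on upper_half_plane"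
    unfolding L_def
    by (rule lift_uhp_holomorphic[OF G_meromorphic]) (simp add: G_poles orbit0_cusp_neq)
  have L_T: "L (\<tau> + 1) = L \<tau>" if "\<tau> \<in> upper_half_plane" for \<tau>
    using Gamma0[OF that, of 1 1 1 0] by simp

  define c' where "c' m = (if m = 0 then 0 else c m)" for m
  \<comment> \<open>The holomorphy of \<open>modular_j\<close> is read off its \<open>q\<close>-expansion, which converges on the whole upper
    half-plane.\<close>
  define r where "r \<tau> = modular_j \<tau> - inverse (qpar \<tau>) - 744" for \<tau>
  have r_sum: "((\<lambda>m. c' m * qpar \<tau> ^ m) has_sum r \<tau>) UNIV" if "\<tau> \<in> upper_half_plane" for \<tau>
    using j_expansion[OF that] unfolding r_def
    by (subst has_sum_cong_neutral[of "{1..}" UNIV "\<lambda>m. c m * qpar \<tau> ^ m"])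
       (auto simp: c'_def)
  have r_hol: "r holomorphic_on upper_half_plane"
    using r_sum by (rule q_series_holomorphic)
  define f where "f \<tau> = fricke_trace p L \<tau> - inverse (qpar \<tau>) - r \<tau>" for \<tau>
  have f_eq: "f \<tau> = fricke_trace p L \<tau> - modular_j \<tau> + 744" for \<tau>
    by (simp add: f_def r_def)
  have f_hol: "f holomorphic_on upper_half_plane"
    unfolding f_def
    by (intro holomorphic_intros fricke_trace_holomorphic pos L_hol r_hol)
       (auto simp: qpar_def[abs_def] intro!: holomorphic_intros)
  have coeff: "c m = of_nat p * \<alpha> (p * m) + \<alpha> m" if "m > 0" for m
  proof -
    have "\<alpha> m + of_nat p * \<alpha> (p * m) - c' m = 0"
    proof (rule S_T_invariant_q_series_trivial[OF f_hol])
      fix \<tau> assume \<tau>: "\<tau> \<in> upper_half_plane"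
      then show "f (\<tau> + 1) = f \<tau>"
        by (simp add: f_eq modular_j_T fricke_trace_T[of p \<tau> L, OF pos(1) \<tau> L_T])
      from \<tau> have "\<tau> \<noteq> 0" by (auto simp: upper_half_plane_def)
      show "f (- 1 / \<tau>) = f \<tau>"
        by (simp only: f_eq modular_j_S[OF \<open>\<tau> \<noteq> 0\<close>]
            fricke_trace_S[of p \<tau> L, OF prime \<tau> Gamma0 fricke])
    next
      have "\<forall>\<^sub>F \<tau> in at_i_infinity. \<tau> \<in> upper_half_plane"
        unfolding at_i_infinity_def eventually_filtercomap_at_top_dense
        by (intro exI[of _ 0]) (simp add: upper_half_plane_def)
      with fricke_trace_expansion[OF pos(2) G_expansion[folded L_def]]
      show "\<forall>\<^sub>F \<tau> in at_i_infinity.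
          ((\<lambda>m. (\<alpha> m + of_nat p * \<alpha> (p * m) - c' m) * qpar \<tau> ^ m) has_sum f \<tau>) UNIV"
      proof eventually_elim
        case (elim \<tau>)
        from has_sum_add[OF elim(1) has_sum_cmult_right[OF r_sum[OF elim(2)], of "- 1"]]
        show ?case by (simp add: f_def algebra_simps)
      qed
    qed (use that in auto)
    with that show ?thesis by (simp add: c'_def add.commute)
  qed
  obtain K where K: "k = Suc K" using k by (cases k) auto
  have "(\<Sum>i = 0..K. (- 1) ^ (K - i) * (of_nat p ^ i * c (p ^ i * n))) =
      of_nat p ^ Suc K * \<alpha> (p ^ Suc K * n) + (- 1) ^ K * (of_nat p ^ 0 * \<alpha> (p ^ 0 * n))"
  proof (rule alternating_telescope)
    fix i
    have "p ^ i * n > 0" using pos n by simp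
    from coeff[OF this]
    show "of_nat p ^ i * c (p ^ i * n) =
        of_nat p ^ Suc i * \<alpha> (p ^ Suc i * n) + of_nat p ^ i * \<alpha> (p ^ i * n)"
      by (simp add: algebra_simps)
  qed
  then show ?thesis by (simp add: K mult.assoc)
qed

end
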